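(* Let $K$ be a field, let $Q$ be a finite quiver with path connected components $D_1,\dots,D_m$, let $w_i$ be a chosen vertex in $D_i$ for each $i$, and let $\{x_1,\dots,x_m\}$ be the vertex set of the skeleton $Sk(Q)$ of $KQ$, where $x_i$ corresponds to $D_i$. Setting $x_i\le x_j$ if and only if there is a path from $w_i\in D_i$ to $w_j\in D_j$ in $Q$ is a partial ordering of the vertex set of $Sk(Q)$.
   Context: Paths in $Q$ include the paths of length zero (the vertices). On the vertex set of $Q$ define $v\sim w$ if there are paths from $v$ to $w$ and from $w$ to $v$; the equivalence classes are the path connected components of $Q$. Two paths are parallel if they have the same start vertex and the same end vertex; $C$ is the two-sided ideal of $KQ$ generated by all differences $p-q$ of parallel paths, and $KQ/C$ is the commuting algebra of $KQ$, with canonical surjection $\rho\colon KQ\to KQ/C$. The skeleton of $KQ$ is $Sk(Q)=\mathrm{End}_{KQ/C}(P)$, where $P=\bigoplus_{i=1}^m\rho(w_i)KQ/C$ as a right $KQ/C$-module. Its vertices $x_1,\dots,x_m$ are in one-to-one correspondence with the path connected components $D_1,\dots,D_m$ ($x_i$ corresponding to the summand $\rho(w_i)KQ/C$ of $P$). *)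

theory Defs
  imports "HOL-Algebra.Algebra" "Graph_Theory.Arc_Walk"
begin

text \<open>
  A finite quiver is a \<^locale>\<open>fin_digraph\<close>: finitely many vertices and arcs, with loops and
  multiple arcs allowed. A path is a triple of its start vertex, its list of arcs and its end
  vertex, so the paths of length zero are the triples \<open>(v, [], v)\<close>.
\<close>

type_synonym ('v, 'e) qpath = "'v \<times> 'e list \<times> 'v"

definition qpaths :: "('v, 'e) pre_digraph \<Rightarrow> ('v, 'e) qpath set" where
  "qpaths G = {(u, es, v). pre_digraph.awalk G u es v}"

definition qpath_start :: "('v, 'e) qpath \<Rightarrow> 'v" where
  "qpath_start p = fst p"

definition qpath_end :: "('v, 'e) qpath \<Rightarrow> 'v" where
  "qpath_end p = snd (snd p)"

definition vertex_path :: "'v \<Rightarrow> ('v, 'e) qpath" where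
  "vertex_path v = (v, [], v)"

definition qpath_append :: "('v, 'e) qpath \<Rightarrow> ('v, 'e) qpath \<Rightarrow> ('v, 'e) qpath" where
  "qpath_append p q = (fst p, fst (snd p) @ fst (snd q), snd (snd q))"

definition path_between :: "('v, 'e) pre_digraph \<Rightarrow> 'v \<Rightarrow> 'v \<Rightarrow> bool" where
  "path_between G u v \<longleftrightarrow> (\<exists>p \<in> qpaths G. qpath_start p = u \<and> qpath_end p = v)"

definition parallel_paths :: "('v, 'e) qpath \<Rightarrow> ('v, 'e) qpath \<Rightarrow> bool" where
  "parallel_paths p q \<longleftrightarrow> qpath_start p = qpath_start q \<and> qpath_end p = qpath_end q"

definition path_equiv :: "('v, 'e) pre_digraph \<Rightarrow> 'v rel" where
  "path_equiv G = {(v, w). v \<in> verts G \<and> w \<in> verts G \<and> path_between G v w \<and> path_between G w v}"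

definition path_connected_components :: "('v, 'e) pre_digraph \<Rightarrow> 'v set set" where
  "path_connected_components G = verts G // path_equiv G"

text \<open>
  Elements of the path algebra are the finitely supported functions from paths to \<open>K\<close>,
  extended by zero to triples that are not paths. Paths multiply by concatenation from left to
  right: \<open>p q\<close> is first \<open>p\<close>, then \<open>q\<close>, and it is zero if \<open>p\<close> does not end where \<open>q\<close> starts.
  The set over which the product sums is finite, since a path has only finitely many
  factorizations. The identity is the sum of all vertices.
\<close>

definition path_algebra ::
  "('k, 'm) ring_scheme \<Rightarrow> ('v, 'e) pre_digraph \<Rightarrow> ('k, ('v, 'e) qpath \<Rightarrow> 'k) module" where
  "path_algebra K G =
    \<lparr>carrier = {f. (\<forall>p \<in> qpaths G. f p \<in> carrier K) \<and> (\<forall>p. p \<notin> qpaths G \<longrightarrow> f p = \<zero>\<^bsub>K\<^esub>) \<and>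
                   finite {p. f p \<noteq> \<zero>\<^bsub>K\<^esub>}},
     monoid.mult = (\<lambda>f g r. finsum K (\<lambda>(p, q). f p \<otimes>\<^bsub>K\<^esub> g q)
               {(p, q). p \<in> qpaths G \<and> q \<in> qpaths G \<and> qpath_end p = qpath_start q \<and>
                        qpath_append p q = r}),
     one = (\<lambda>p. if p \<in> vertex_path ` verts G then \<one>\<^bsub>K\<^esub> else \<zero>\<^bsub>K\<^esub>),
     ring.zero = (\<lambda>p. \<zero>\<^bsub>K\<^esub>),
     ring.add = (\<lambda>f g p. f p \<oplus>\<^bsub>K\<^esub> g p),
     smult = (\<lambda>c f p. c \<otimes>\<^bsub>K\<^esub> f p)\<rparr>"

definition path_elem :: "('k, 'm) ring_scheme \<Rightarrow> ('v, 'e) qpath \<Rightarrow> ('v, 'e) qpath \<Rightarrow> 'k" where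
  "path_elem K p = (\<lambda>q. if q = p then \<one>\<^bsub>K\<^esub> else \<zero>\<^bsub>K\<^esub>)"

text \<open>
  Since the path algebra is unital, a two-sided ring ideal is automatically closed under
  scalars from \<open>K\<close>.
\<close>

definition commuting_ideal ::
  "('k, 'm) ring_scheme \<Rightarrow> ('v, 'e) pre_digraph \<Rightarrow> (('v, 'e) qpath \<Rightarrow> 'k) set" where
  "commuting_ideal K G =
    Idl\<^bsub>path_algebra K G\<^esub>
      {path_elem K p \<ominus>\<^bsub>path_algebra K G\<^esub> path_elem K q | p q.
         p \<in> qpaths G \<and> q \<in> qpaths G \<and> parallel_paths p q}"

definition commuting_proj ::
  "('k, 'm) ring_scheme \<Rightarrow> ('v, 'e) pre_digraph \<Rightarrow>
   (('v, 'e) qpath \<Rightarrow> 'k) \<Rightarrow> (('v, 'e) qpath \<Rightarrow> 'k) set" where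
  "commuting_proj K G f = commuting_ideal K G +>\<^bsub>path_algebra K G\<^esub> f"

definition commuting_algebra ::
  "('k, 'm) ring_scheme \<Rightarrow> ('v, 'e) pre_digraph \<Rightarrow> ('k, (('v, 'e) qpath \<Rightarrow> 'k) set) module" where
  "commuting_algebra K G =
    ring.extend (path_algebra K G Quot commuting_ideal K G)
      (module.fields (\<lambda>c S. \<Union>f \<in> S. commuting_proj K G (c \<odot>\<^bsub>path_algebra K G\<^esub> f)))"

text \<open>
  Right modules over a possibly noncommutative ring: the monoid operation and unit are the
  addition and the zero of the underlying abelian group, and \<open>ract\<close> is the right action.
\<close>

record ('a, 'b) right_module = "'b monoid" +
  ract :: "'b \<Rightarrow> 'a \<Rightarrow> 'b"

definition principal_right_module :: "('a, 'm) ring_scheme \<Rightarrow> 'a \<Rightarrow> ('a, 'a) right_module" where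
  "principal_right_module A e =
    \<lparr>carrier = e <#\<^bsub>A\<^esub> carrier A, monoid.mult = ring.add A, one = ring.zero A, ract = monoid.mult A\<rparr>"

text \<open>
  The direct sum of a finite family, realized as the product of the family.
\<close>

definition finite_direct_sum ::
  "'i set \<Rightarrow> ('i \<Rightarrow> ('a, 'b) right_module) \<Rightarrow> ('a, 'i \<Rightarrow> 'b) right_module" where
  "finite_direct_sum I M =
    monoid.extend (product_group I M)
      (right_module.fields (\<lambda>z a. \<lambda>i\<in>I. ract (M i) (z i) a))"

text \<open>
  Endomorphisms are taken to be undefined outside the carrier and act on the left, so that the
  product \<open>f g\<close> is \<open>f\<close> after \<open>g\<close>. A scalar \<open>c\<close> acts through the central element \<open>c 1\<close> of \<open>A\<close>.
\<close>

definition module_End ::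
  "('k, 'a) module \<Rightarrow> ('a, 'b) right_module \<Rightarrow> ('k, 'b \<Rightarrow> 'b) module" where
  "module_End A M =
    \<lparr>carrier = {f \<in> hom M M \<inter> extensional (carrier M).
                 \<forall>z \<in> carrier M. \<forall>a \<in> carrier A. f (ract M z a) = ract M (f z) a},
     monoid.mult = (\<lambda>f g. compose (carrier M) f g),
     one = (\<lambda>z \<in> carrier M. z),
     ring.zero = (\<lambda>z \<in> carrier M. \<one>\<^bsub>M\<^esub>),
     ring.add = (\<lambda>f g. \<lambda>z \<in> carrier M. f z \<otimes>\<^bsub>M\<^esub> g z),
     smult = (\<lambda>c f. \<lambda>z \<in> carrier M. ract M (f z) (c \<odot>\<^bsub>A\<^esub> \<one>\<^bsub>A\<^esub>))\<rparr>"

definition skeleton_module ::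
  "('k, 'm) ring_scheme \<Rightarrow> ('v, 'e) pre_digraph \<Rightarrow> 'i set \<Rightarrow> ('i \<Rightarrow> 'v) \<Rightarrow>
   ((('v, 'e) qpath \<Rightarrow> 'k) set, 'i \<Rightarrow> (('v, 'e) qpath \<Rightarrow> 'k) set) right_module" where
  "skeleton_module K G I w =
    finite_direct_sum I
      (\<lambda>i. principal_right_module (commuting_algebra K G)
              (commuting_proj K G (path_elem K (vertex_path (w i)))))"

definition skeleton ::
  "('k, 'm) ring_scheme \<Rightarrow> ('v, 'e) pre_digraph \<Rightarrow> 'i set \<Rightarrow> ('i \<Rightarrow> 'v) \<Rightarrow>
   ('k, ('i \<Rightarrow> (('v, 'e) qpath \<Rightarrow> 'k) set) \<Rightarrow> ('i \<Rightarrow> (('v, 'e) qpath \<Rightarrow> 'k) set)) module" where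
  "skeleton K G I w = module_End (commuting_algebra K G) (skeleton_module K G I w)"

text \<open>
  As a path of length zero, the vertex \<open>x\<^sub>i\<close> of the skeleton is an idempotent of the
  endomorphism algebra: the projection of the direct sum onto its \<open>i\<close>-th summand.
\<close>

definition skeleton_vertex ::
  "('k, 'm) ring_scheme \<Rightarrow> ('v, 'e) pre_digraph \<Rightarrow> 'i set \<Rightarrow> ('i \<Rightarrow> 'v) \<Rightarrow> 'i \<Rightarrow>
   ('i \<Rightarrow> (('v, 'e) qpath \<Rightarrow> 'k) set) \<Rightarrow> ('i \<Rightarrow> (('v, 'e) qpath \<Rightarrow> 'k) set)" where
  "skeleton_vertex K G I w i =
    (\<lambda>z \<in> carrier (skeleton_module K G I w).
       \<lambda>j\<in>I. if j = i then z j else \<zero>\<^bsub>commuting_algebra K G\<^esub>)"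

definition skeleton_vertices ::
  "('k, 'm) ring_scheme \<Rightarrow> ('v, 'e) pre_digraph \<Rightarrow> 'i set \<Rightarrow> ('i \<Rightarrow> 'v) \<Rightarrow>
   (('i \<Rightarrow> (('v, 'e) qpath \<Rightarrow> 'k) set) \<Rightarrow> ('i \<Rightarrow> (('v, 'e) qpath \<Rightarrow> 'k) set)) set" where
  "skeleton_vertices K G I w =
    {x \<in> carrier (skeleton K G I w). \<exists>i \<in> I. x = skeleton_vertex K G I w i}"

definition skeleton_le ::
  "('k, 'm) ring_scheme \<Rightarrow> ('v, 'e) pre_digraph \<Rightarrow> 'i set \<Rightarrow> ('i \<Rightarrow> 'v) \<Rightarrow>
   (('i \<Rightarrow> (('v, 'e) qpath \<Rightarrow> 'k) set) \<Rightarrow> ('i \<Rightarrow> (('v, 'e) qpath \<Rightarrow> 'k) set)) rel" where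
  "skeleton_le K G I w =
    {(skeleton_vertex K G I w i, skeleton_vertex K G I w j) | i j.
       i \<in> I \<and> j \<in> I \<and> path_between G (w i) (w j)}"

end

theory Submission
  imports Defs
begin

text \<open>
  Reachability by paths is reflexive, because of the paths of length zero, and transitive, because
  paths can be concatenated, and if \<open>w\<^sub>i\<close> and \<open>w\<^sub>j\<close> reach each other then they lie in the same
  path connected component, so \<open>i = j\<close>. Hence \<open>i \<le> j\<close> is a partial order on the indices. The
  remaining point is that it transports to the vertices of the skeleton: these are the projections
  of \<open>P\<close> onto its summands, and one has to know that they are endomorphisms of \<open>P\<close> and that
  different indices give different projections.

  Both facts hold for every direct sum of principal right modules \<open>e\<^sub>i A\<close> over a ring \<open>A\<close>, provided
  that every \<open>e\<^sub>i\<close> is nonzero (\<open>summand_projection_in_module_End\<close>, \<open>inj_on_summand_projection\<close>).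
  Thus it has to be shown that \<open>KQ\<close> is a ring, so that \<open>C\<close> is an ideal and \<open>KQ/C\<close> is a ring, and
  that the class of a vertex in \<open>KQ/C\<close> is nonzero.

  For the latter, send \<open>f\<close> in \<open>KQ\<close> to the matrix over \<open>K\<close> whose entry at \<open>(u, v)\<close> is the sum of the
  coefficients of \<open>f\<close> at all paths from \<open>u\<close> to \<open>v\<close>. A path from \<open>u\<close> to \<open>v\<close> becomes the matrix unit
  at \<open>(u, v)\<close>, so this map is multiplicative (\<open>path_sum_mult\<close>), it sends parallel paths to the same
  matrix, and it sends no path to zero. Its kernel is therefore an ideal that contains \<open>C\<close> but no path.
\<close>

section \<open>Finite sums in abelian monoids and rings\<close>

context abelian_monoid
begin

lemma finsum_fibres:
  assumes "finite C" "finite S" "h ` C \<subseteq> S" "f \<in> C \<rightarrow> carrier G"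
  shows "(\<Oplus>s\<in>S. \<Oplus>c\<in>{c \<in> C. h c = s}. f c) = (\<Oplus>c\<in>C. f c)"
proof -
  have "C = (\<Union>s\<in>S. {c \<in> C. h c = s})"
    using assms(3) by auto
  moreover have "pairwise (\<lambda>s t. disjnt {c \<in> C. h c = s} {c \<in> C. h c = t}) S"
    by (auto simp: pairwise_def disjnt_def)
  ultimately show ?thesis
    using add.finprod_UN_disjoint[of S "\<lambda>s. {c \<in> C. h c = s}" f] assms
    by (auto simp: Pi_iff)
qed

text \<open>
  Used for products with the identity, a sum of vertices, where a single factorization contributes.
\<close>

lemma finsum_only_term:
  assumes "finite A" "a \<in> A" "f \<in> A \<rightarrow> carrier G"
    and "\<And>x. x \<in> A \<Longrightarrow> x \<noteq> a \<Longrightarrow> f x = \<zero>"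
  shows "(\<Oplus>x\<in>A. f x) = f a"
proof -
  have "(\<Oplus>x\<in>A. f x) = (\<Oplus>x\<in>{a}. f x)"
    by (rule add.finprod_mono_neutral_cong_right) (use assms in auto)
  also have "\<dots> = f a"
    using assms finsum_insert[of "{}" a f] by (auto simp: Pi_iff)
  finally show ?thesis .
qed

end

text \<open>
  Sum over pairs by grouping them according to their first component.
\<close>

lemma (in semiring) finsum_product:
  assumes "finite A" "finite B" "f \<in> A \<rightarrow> carrier R" "g \<in> B \<rightarrow> carrier R"
  shows "(\<Oplus>p\<in>A. f p) \<otimes> (\<Oplus>q\<in>B. g q) = finsum R (\<lambda>(p, q). f p \<otimes> g q) (A \<times> B)"
proof -
  have B: "(\<Oplus>q\<in>B. g q) \<in> carrier R"
    using assms by simp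
  have "(\<Oplus>p\<in>A. f p) \<otimes> (\<Oplus>q\<in>B. g q) = (\<Oplus>p\<in>A. f p \<otimes> (\<Oplus>q\<in>B. g q))"
    by (rule finsum_ldistr) (use assms B in auto)
  also have "\<dots> = (\<Oplus>p\<in>A. \<Oplus>c\<in>{c \<in> A \<times> B. fst c = p}. f (fst c) \<otimes> g (snd c))"
  proof (rule finsum_cong')
    fix p assume p: "p \<in> A"
    have "(\<Oplus>c\<in>{c \<in> A \<times> B. fst c = p}. f (fst c) \<otimes> g (snd c)) =
          (\<Oplus>c\<in>Pair p ` B. f (fst c) \<otimes> g (snd c))"
      by (rule finsum_cong') (use p assms in \<open>auto simp: Pi_def\<close>)
    also have "\<dots> = (\<Oplus>q\<in>B. f p \<otimes> g q)"
      using p assms by (subst finsum_reindex) (auto simp: inj_on_def Pi_def)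
    also have "\<dots> = f p \<otimes> (\<Oplus>q\<in>B. g q)"
      using p assms by (intro finsum_rdistr[symmetric]) auto
    finally show "f p \<otimes> (\<Oplus>q\<in>B. g q) =
        (\<Oplus>c\<in>{c \<in> A \<times> B. fst c = p}. f (fst c) \<otimes> g (snd c))" ..
  qed (use assms in \<open>auto simp: Pi_def\<close>)
  also have "\<dots> = (\<Oplus>c\<in>A \<times> B. f (fst c) \<otimes> g (snd c))"
    by (rule finsum_fibres) (use assms in \<open>auto simp: Pi_iff\<close>)
  finally show ?thesis
    by (simp add: case_prod_unfold)
qed

text \<open>
  The ring axioms do not see the additional scalar multiplication, so this carries them from the
  quotient ring to the quotient algebra.
\<close>

lemma ring_extend:
  fixes R :: "'a ring" and Z :: 'm
  assumes "ring R"
  shows "ring (ring.extend R Z)"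
proof -
  interpret R: ring R
    by fact
  show ?thesis
    by (intro ringI abelian_groupI monoidI)
      (auto simp: ring.extend_def R.m_assoc R.l_distr R.r_distr R.a_ac
        intro: R.add.l_inv_ex)
qed

section \<open>The path algebra is a ring\<close>

text \<open>
  The index set of the sum that defines a coefficient of a product in the path algebra.
\<close>

definition factorizations :: "('v, 'e) pre_digraph \<Rightarrow> ('v, 'e) qpath \<Rightarrow> (('v, 'e) qpath \<times> ('v, 'e) qpath) set" where
  "factorizations G r =
     {(p, q). p \<in> qpaths G \<and> q \<in> qpaths G \<and> qpath_end p = qpath_start q \<and> qpath_append p q = r}"

lemma qpath_start_append [simp]: "qpath_start (qpath_append p q) = qpath_start p"
  and qpath_end_append [simp]: "qpath_end (qpath_append p q) = qpath_end q"
  by (simp_all add: qpath_start_def qpath_end_def qpath_append_def)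

lemma qpath_append_assoc: "qpath_append (qpath_append p q) r = qpath_append p (qpath_append q r)"
  by (simp add: qpath_append_def)

lemma qpath_ends_vertex_path [simp]:
  "qpath_start (vertex_path v) = v" "qpath_end (vertex_path v) = v"
  by (simp_all add: qpath_start_def qpath_end_def vertex_path_def)

lemma qpath_append_vertex_path [simp]:
  "qpath_append (vertex_path (qpath_start p)) p = p"
  "qpath_append p (vertex_path (qpath_end p)) = p"
  by (simp_all add: qpath_append_def qpath_start_def qpath_end_def vertex_path_def)

context wf_digraph
begin

lemma qpath_append_in_qpaths:
  assumes "p \<in> qpaths G" "q \<in> qpaths G" "qpath_end p = qpath_start q"
  shows "qpath_append p q \<in> qpaths G"
  using assms
  by (auto simp: qpaths_def qpath_append_def qpath_end_def qpath_start_def intro: awalk_appendI)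

lemma qpath_ends_in_verts:
  assumes "p \<in> qpaths G"
  shows "qpath_start p \<in> verts G" "qpath_end p \<in> verts G"
  using assms
  by (auto simp: qpaths_def qpath_end_def qpath_start_def awalk_hd_in_verts awalk_last_in_verts)

lemma vertex_path_in_qpaths: "v \<in> verts G \<Longrightarrow> vertex_path v \<in> qpaths G"
  by (simp add: qpaths_def vertex_path_def awalk_Nil_iff)

lemma factorizations_outside: "r \<notin> qpaths G \<Longrightarrow> factorizations G r = {}"
  using qpath_append_in_qpaths by (auto simp: factorizations_def)

end

text \<open>
  A factorization is determined by the length of its first factor and by the vertex where the
  factors meet.
\<close>

lemma (in fin_digraph) finite_factorizations: "finite (factorizations G r)"
proof -
  obtain u es v where r: "r = (u, es, v)"
    by (cases r)
  let ?cut = "\<lambda>(k, x). ((u, take k es, x), (x, drop k es, v))"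
  have "factorizations G r \<subseteq> ?cut ` ({..length es} \<times> verts G)"
  proof (clarify)
    fix p\<^sub>1 es\<^sub>1 x q\<^sub>1 es\<^sub>2 q\<^sub>3
    assume pq: "((p\<^sub>1, es\<^sub>1, x), (q\<^sub>1, es\<^sub>2, q\<^sub>3)) \<in> factorizations G r"
    then have "(p\<^sub>1, es\<^sub>1, x) \<in> qpaths G"
      by (simp add: factorizations_def)
    then have "x \<in> verts G"
      using qpath_ends_in_verts(2) by (fastforce simp: qpath_end_def)
    moreover have "((p\<^sub>1, es\<^sub>1, x), (q\<^sub>1, es\<^sub>2, q\<^sub>3)) = ?cut (length es\<^sub>1, x)"
      and "length es\<^sub>1 \<le> length es"
      using pq r by (auto simp: factorizations_def qpath_append_def qpath_end_def qpath_start_def)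
    ultimately show "((p\<^sub>1, es\<^sub>1, x), (q\<^sub>1, es\<^sub>2, q\<^sub>3)) \<in> ?cut ` ({..length es} \<times> verts G)"
      by blast
  qed
  then show ?thesis
    by (rule finite_subset) simp
qed

locale quiver_over_ring = ring K + fin_digraph G
  for K :: "('k, 'm) ring_scheme" (structure) and G :: "('v, 'e) pre_digraph"
begin

abbreviation KG :: "('k, ('v, 'e) qpath \<Rightarrow> 'k) module" where
  "KG \<equiv> path_algebra K G"

lemma path_algebra_simps:
  "f \<oplus>\<^bsub>KG\<^esub> g = (\<lambda>p. f p \<oplus> g p)"
  "\<zero>\<^bsub>KG\<^esub> = (\<lambda>p. \<zero>)"
  "\<one>\<^bsub>KG\<^esub> = (\<lambda>p. if p \<in> vertex_path ` verts G then \<one> else \<zero>)"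
  "f \<otimes>\<^bsub>KG\<^esub> g = (\<lambda>r. finsum K (\<lambda>(p, q). f p \<otimes> g q) (factorizations G r))"
  by (simp_all add: path_algebra_def factorizations_def)

lemma path_algebra_carrier_iff:
  "f \<in> carrier KG \<longleftrightarrow>
     (\<forall>p. f p \<in> carrier K) \<and> {p. f p \<noteq> \<zero>} \<subseteq> qpaths G \<and> finite {p. f p \<noteq> \<zero>}"
proof -
  have "(\<forall>p \<in> qpaths G. f p \<in> carrier K) \<longleftrightarrow> (\<forall>p. f p \<in> carrier K)"
    if "\<forall>p. p \<notin> qpaths G \<longrightarrow> f p = \<zero>"
    using that by (metis zero_closed)
  moreover have "(\<forall>p. p \<notin> qpaths G \<longrightarrow> f p = \<zero>) \<longleftrightarrow> {p. f p \<noteq> \<zero>} \<subseteq> qpaths G"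
    by blast
  ultimately show ?thesis
    unfolding path_algebra_def partial_object.select_convs mem_Collect_eq by blast
qed

lemma path_algebra_carrierI:
  assumes "\<And>p. f p \<in> carrier K" "\<And>p. f p \<noteq> \<zero> \<Longrightarrow> p \<in> S" "S \<subseteq> qpaths G" "finite S"
  shows "f \<in> carrier KG"
proof -
  have "{p. f p \<noteq> \<zero>} \<subseteq> S"
    using assms(2) by blast
  then have "{p. f p \<noteq> \<zero>} \<subseteq> qpaths G" "finite {p. f p \<noteq> \<zero>}"
    using assms(3,4) finite_subset by blast+
  then show ?thesis
    using assms(1) unfolding path_algebra_carrier_iff by blast
qed

lemma coeff_outside: "f \<in> carrier KG \<Longrightarrow> p \<notin> qpaths G \<Longrightarrow> f p = \<zero>"
  unfolding path_algebra_carrier_iff by blast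

lemma support_subset: "f \<in> carrier KG \<Longrightarrow> {p. f p \<noteq> \<zero>} \<subseteq> qpaths G"
  and finite_support: "f \<in> carrier KG \<Longrightarrow> finite {p. f p \<noteq> \<zero>}"
  unfolding path_algebra_carrier_iff by blast+

lemma coeff_closed [simp]: "f \<in> carrier KG \<Longrightarrow> f p \<in> carrier K"
  unfolding path_algebra_carrier_iff by blast

lemma convolution_summand_closed [simp]:
  "f \<in> carrier KG \<Longrightarrow> g \<in> carrier KG \<Longrightarrow> (\<lambda>(p, q). f p \<otimes> g q) \<in> A \<rightarrow> carrier K"
  by auto

lemma convolution_nonzeroE:
  assumes "f \<in> carrier KG" "g \<in> carrier KG" "(f \<otimes>\<^bsub>KG\<^esub> g) r \<noteq> \<zero>"
  obtains p q where "(p, q) \<in> factorizations G r" "f p \<noteq> \<zero>" "g q \<noteq> \<zero>"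
proof -
  have "\<not> (\<forall>c\<in>factorizations G r. (case c of (p, q) \<Rightarrow> f p \<otimes> g q) = \<zero>)"
    using assms(3) add.finprod_one_eqI[of "factorizations G r" "\<lambda>(p, q). f p \<otimes> g q"]
    unfolding path_algebra_simps by blast
  then obtain p q where "(p, q) \<in> factorizations G r" "f p \<otimes> g q \<noteq> \<zero>"
    by auto
  moreover from this have "f p \<noteq> \<zero>" "g q \<noteq> \<zero>"
    using assms by auto
  ultimately show thesis
    using that by blast
qed

lemma path_algebra_mult_closed:
  assumes "f \<in> carrier KG" "g \<in> carrier KG"
  shows "f \<otimes>\<^bsub>KG\<^esub> g \<in> carrier KG"
proof -
  let ?A = "{p. f p \<noteq> \<zero>}" and ?B = "{p. g p \<noteq> \<zero>}"
  let ?S = "(\<lambda>(p, q). qpath_append p q) ` (?A \<times> ?B) \<inter> qpaths G"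
  show ?thesis
  proof (rule path_algebra_carrierI)
    fix r
    show "(f \<otimes>\<^bsub>KG\<^esub> g) r \<in> carrier K"
      using assms by (simp add: path_algebra_simps)
    assume "(f \<otimes>\<^bsub>KG\<^esub> g) r \<noteq> \<zero>"
    with assms obtain p q
      where pq: "(p, q) \<in> factorizations G r" "f p \<noteq> \<zero>" "g q \<noteq> \<zero>"
      by (rule convolution_nonzeroE)
    then have "p \<in> ?A" "q \<in> ?B"
      by simp_all
    moreover have "r = qpath_append p q" "r \<in> qpaths G"
      using pq factorizations_outside[of r] unfolding factorizations_def by blast+
    ultimately show "r \<in> ?S"
      by auto
  next
    show "finite ?S"
      using assms[THEN finite_support]
      by (intro finite_Int disjI1 finite_imageI finite_cartesian_product)
  qed auto
qed

text \<open>
  Both sides are the sum of \<open>f p \<otimes> g q \<otimes> h t\<close> over the set \<open>T\<close> of all factorizations of \<open>r\<close> into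
  three paths \<open>p\<close>, \<open>q\<close>, \<open>t\<close>. The left side groups the triples by \<open>(p q, t)\<close>, through \<open>\<phi>\<close>, and the
  right side by \<open>(p, q t)\<close>, through \<open>\<psi>\<close>.
\<close>

lemma path_algebra_assoc:
  assumes f: "f \<in> carrier KG" and g: "g \<in> carrier KG" and h: "h \<in> carrier KG"
  shows "(f \<otimes>\<^bsub>KG\<^esub> g) \<otimes>\<^bsub>KG\<^esub> h = f \<otimes>\<^bsub>KG\<^esub> (g \<otimes>\<^bsub>KG\<^esub> h)"
proof
  fix r
  define T where "T = {(p, q, t). p \<in> qpaths G \<and> q \<in> qpaths G \<and> t \<in> qpaths G \<and>
    qpath_end p = qpath_start q \<and> qpath_end q = qpath_start t \<and>
    qpath_append p (qpath_append q t) = r}"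
  define F where "F = (\<lambda>(p, q, t). f p \<otimes> g q \<otimes> h t)"
  define \<phi> :: "('v, 'e) qpath \<times> ('v, 'e) qpath \<times> ('v, 'e) qpath \<Rightarrow> ('v, 'e) qpath \<times> ('v, 'e) qpath"
    where "\<phi> = (\<lambda>(p, q, t). (qpath_append p q, t))"
  define \<psi> :: "('v, 'e) qpath \<times> ('v, 'e) qpath \<times> ('v, 'e) qpath \<Rightarrow> ('v, 'e) qpath \<times> ('v, 'e) qpath"
    where "\<psi> = (\<lambda>(p, q, t). (p, qpath_append q t))"
  have F: "F \<in> A \<rightarrow> carrier K" for A
    using f g h by (auto simp: F_def)
  \<comment> \<open>The fibres of the two groupings are the inner index sets of the iterated products.\<close>
  have left: "{c \<in> T. \<phi> c = (s, t)} = (\<lambda>(p, q). (p, q, t)) ` factorizations G s" (is "?L = ?R")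
    if st: "(s, t) \<in> factorizations G r" for s t
  proof (rule equalityI; rule subsetI)
    fix c assume "c \<in> ?L"
    moreover obtain p q t' where c: "c = (p, q, t')"
      by (rule prod_cases3)
    ultimately have "t' = t" "(p, q) \<in> factorizations G s"
      by (simp_all add: T_def \<phi>_def factorizations_def)
    with c have "c = (p, q, t)" "(p, q) \<in> factorizations G s"
      by simp_all
    then show "c \<in> ?R"
      by force
  next
    fix c assume "c \<in> ?R"
    then obtain d where d: "c = (\<lambda>(p, q). (p, q, t)) d" "d \<in> factorizations G s"
      by (rule imageE)
    moreover obtain p q where "d = (p, q)"
      by (rule prod.exhaust)
    ultimately have c: "c = (p, q, t)" and "(p, q) \<in> factorizations G s"
      by simp_all
    then have pq: "p \<in> qpaths G" "q \<in> qpaths G" "qpath_end p = qpath_start q" "qpath_append p q = s"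
      unfolding factorizations_def by blast+
    moreover from st have t: "t \<in> qpaths G" "qpath_end s = qpath_start t" "qpath_append s t = r"
      unfolding factorizations_def by blast+
    moreover have "qpath_end q = qpath_start t" "qpath_append p (qpath_append q t) = r"
      using pq t qpath_end_append[of p q] qpath_append_assoc[of p q t] by simp_all
    ultimately show "c \<in> ?L"
      by (simp add: T_def \<phi>_def c)
  qed
  have right: "{c \<in> T. \<psi> c = (p, s)} = Pair p ` factorizations G s" (is "?L = ?R")
    if ps: "(p, s) \<in> factorizations G r" for p s
  proof (rule equalityI; rule subsetI)
    fix c assume "c \<in> ?L"
    moreover obtain p' q t where c: "c = (p', q, t)"
      by (rule prod_cases3)
    ultimately have "p' = p" "(q, t) \<in> factorizations G s"
      by (simp_all add: T_def \<psi>_def factorizations_def)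
    with c have "c = (p, q, t)" "(q, t) \<in> factorizations G s"
      by simp_all
    then show "c \<in> ?R"
      by force
  next
    fix c assume "c \<in> ?R"
    then obtain d where "c = (p, d)" "d \<in> factorizations G s"
      by (rule imageE)
    moreover obtain q t where "d = (q, t)"
      by (rule prod.exhaust)
    ultimately have c: "c = (p, q, t)" and "(q, t) \<in> factorizations G s"
      by simp_all
    then have qt: "q \<in> qpaths G" "t \<in> qpaths G" "qpath_end q = qpath_start t" "qpath_append q t = s"
      unfolding factorizations_def by blast+
    moreover from ps have p: "p \<in> qpaths G" "qpath_end p = qpath_start s" "qpath_append p s = r"
      unfolding factorizations_def by blast+
    moreover have "qpath_end p = qpath_start q"
      using p qt qpath_start_append[of q t] by simp
    ultimately show "c \<in> ?L"
      by (simp add: T_def \<psi>_def c)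
  qed
  have maps_left: "\<phi> ` T \<subseteq> factorizations G r"
  proof (rule image_subsetI)
    fix c assume "c \<in> T"
    moreover obtain p q t where "c = (p, q, t)"
      by (rule prod_cases3)
    ultimately show "\<phi> c \<in> factorizations G r"
      by (simp add: T_def \<phi>_def factorizations_def qpath_append_assoc qpath_append_in_qpaths)
  qed
  have maps_right: "\<psi> ` T \<subseteq> factorizations G r"
  proof (rule image_subsetI)
    fix c assume "c \<in> T"
    moreover obtain p q t where "c = (p, q, t)"
      by (rule prod_cases3)
    ultimately show "\<psi> c \<in> factorizations G r"
      by (simp add: T_def \<psi>_def factorizations_def qpath_append_in_qpaths)
  qed
  have "finite {d \<in> T. \<phi> d = c}" if "c \<in> factorizations G r" for c
    using that left[of "fst c" "snd c"] by (simp add: finite_factorizations)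
  then have "finite (\<Union>c\<in>factorizations G r. {d \<in> T. \<phi> d = c})"
    by (rule finite_UN_I[OF finite_factorizations])
  moreover have "T \<subseteq> (\<Union>c\<in>factorizations G r. {d \<in> T. \<phi> d = c})"
    using maps_left by blast
  ultimately have T: "finite T"
    by (rule rev_finite_subset)
  have "((f \<otimes>\<^bsub>KG\<^esub> g) \<otimes>\<^bsub>KG\<^esub> h) r =
      (\<Oplus>c\<in>factorizations G r. \<Oplus>d\<in>{d \<in> T. \<phi> d = c}. F d)"
    unfolding path_algebra_simps
  proof (rule finsum_cong')
    fix c assume "c \<in> factorizations G r"
    moreover obtain s t where c: "c = (s, t)"
      by (cases c)
    ultimately have st: "(s, t) \<in> factorizations G r"
      by simp
    have "finsum K (\<lambda>(p, q). f p \<otimes> g q) (factorizations G s) \<otimes> h t =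
          (\<Oplus>d\<in>factorizations G s. (case d of (p, q) \<Rightarrow> f p \<otimes> g q) \<otimes> h t)"
      by (rule finsum_ldistr) (use f g h finite_factorizations in auto)
    also have "\<dots> = (\<Oplus>d\<in>factorizations G s. F ((\<lambda>(p, q). (p, q, t)) d))"
      by (rule finsum_cong') (use f g h in \<open>auto simp: F_def\<close>)
    also have "\<dots> = (\<Oplus>d\<in>(\<lambda>(p, q). (p, q, t)) ` factorizations G s. F d)"
      by (rule finsum_reindex[symmetric, OF F]) (rule inj_onI, force)
    finally show "(case c of (p, q) \<Rightarrow> finsum K (\<lambda>(p, q). f p \<otimes> g q) (factorizations G p) \<otimes> h q) =
        (\<Oplus>d\<in>{d \<in> T. \<phi> d = c}. F d)"
      by (simp only: c left[OF st] prod.case)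
  qed (auto intro!: finsum_closed[OF F])
  also have "\<dots> = (\<Oplus>d\<in>T. F d)"
    by (rule finsum_fibres[OF T finite_factorizations maps_left F])
  also have "\<dots> =
      (\<Oplus>c\<in>factorizations G r. \<Oplus>d\<in>{d \<in> T. \<psi> d = c}. F d)"
    by (rule finsum_fibres[OF T finite_factorizations maps_right F, symmetric])
  also have "\<dots> = (f \<otimes>\<^bsub>KG\<^esub> (g \<otimes>\<^bsub>KG\<^esub> h)) r"
    unfolding path_algebra_simps
  proof (rule finsum_cong')
    fix c assume "c \<in> factorizations G r"
    moreover obtain p s where c: "c = (p, s)"
      by (cases c)
    ultimately have ps: "(p, s) \<in> factorizations G r"
      by simp
    have "f p \<otimes> finsum K (\<lambda>(q, t). g q \<otimes> h t) (factorizations G s) =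
          (\<Oplus>d\<in>factorizations G s. f p \<otimes> (case d of (q, t) \<Rightarrow> g q \<otimes> h t))"
      by (rule finsum_rdistr) (use f g h finite_factorizations in auto)
    also have "\<dots> = (\<Oplus>d\<in>factorizations G s. F (p, d))"
      by (rule finsum_cong') (use f g h in \<open>auto simp: F_def m_assoc\<close>)
    also have "\<dots> = (\<Oplus>d\<in>Pair p ` factorizations G s. F d)"
      by (rule finsum_reindex[symmetric, OF F]) (rule inj_onI, force)
    finally show "(\<Oplus>d\<in>{d \<in> T. \<psi> d = c}. F d) =
        (case c of (p, q) \<Rightarrow> f p \<otimes> finsum K (\<lambda>(p, q). g p \<otimes> h q) (factorizations G q))"
      by (simp only: c right[OF ps] prod.case)
  qed (use f g h in auto)
  finally show "((f \<otimes>\<^bsub>KG\<^esub> g) \<otimes>\<^bsub>KG\<^esub> h) r = (f \<otimes>\<^bsub>KG\<^esub> (g \<otimes>\<^bsub>KG\<^esub> h)) r" .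
qed

lemma path_algebra_one_closed: "\<one>\<^bsub>KG\<^esub> \<in> carrier KG"
proof (rule path_algebra_carrierI)
  show "vertex_path ` verts G \<subseteq> qpaths G"
    using vertex_path_in_qpaths by blast
  fix p
  show "\<one>\<^bsub>KG\<^esub> p \<in> carrier K"
    by (simp add: path_algebra_simps)
  show "p \<in> vertex_path ` verts G" if "\<one>\<^bsub>KG\<^esub> p \<noteq> \<zero>"
    using that unfolding path_algebra_simps by presburger
qed simp

lemma path_algebra_l_one:
  assumes f: "f \<in> carrier KG"
  shows "\<one>\<^bsub>KG\<^esub> \<otimes>\<^bsub>KG\<^esub> f = f"
proof
  fix r
  show "(\<one>\<^bsub>KG\<^esub> \<otimes>\<^bsub>KG\<^esub> f) r = f r"
  proof (cases "r \<in> qpaths G")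
    case True
    let ?c = "(vertex_path (qpath_start r), r)"
    have c: "?c \<in> factorizations G r"
      using True qpath_ends_in_verts by (simp add: factorizations_def vertex_path_in_qpaths)
    have "(\<one>\<^bsub>KG\<^esub> \<otimes>\<^bsub>KG\<^esub> f) r = (case ?c of (p, q) \<Rightarrow> \<one>\<^bsub>KG\<^esub> p \<otimes> f q)"
      unfolding path_algebra_simps(4)
    proof (rule finsum_only_term[OF finite_factorizations c])
      fix d assume d: "d \<in> factorizations G r" "d \<noteq> ?c"
      obtain p q where pq: "d = (p, q)"
        by (cases d)
      have "p \<notin> vertex_path ` verts G"
      proof
        assume "p \<in> vertex_path ` verts G"
        then obtain v where "p = vertex_path v"
          by auto
        then show False
          using d pq by (auto simp: factorizations_def)
      qed
      then show "(case d of (p, q) \<Rightarrow> \<one>\<^bsub>KG\<^esub> p \<otimes> f q) = \<zero>"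
        using f by (simp add: pq path_algebra_simps)
    qed (use f path_algebra_one_closed in auto)
    then show ?thesis
      using f True qpath_ends_in_verts by (simp add: path_algebra_simps)
  next
    case False
    then show ?thesis
      using f by (simp add: path_algebra_simps factorizations_outside coeff_outside)
  qed
qed

lemma path_algebra_r_one:
  assumes f: "f \<in> carrier KG"
  shows "f \<otimes>\<^bsub>KG\<^esub> \<one>\<^bsub>KG\<^esub> = f"
proof
  fix r
  show "(f \<otimes>\<^bsub>KG\<^esub> \<one>\<^bsub>KG\<^esub>) r = f r"
  proof (cases "r \<in> qpaths G")
    case True
    let ?c = "(r, vertex_path (qpath_end r))"
    have c: "?c \<in> factorizations G r"
      using True qpath_ends_in_verts by (simp add: factorizations_def vertex_path_in_qpaths)
    have "(f \<otimes>\<^bsub>KG\<^esub> \<one>\<^bsub>KG\<^esub>) r = (case ?c of (p, q) \<Rightarrow> f p \<otimes> \<one>\<^bsub>KG\<^esub> q)"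
      unfolding path_algebra_simps(4)
    proof (rule finsum_only_term[OF finite_factorizations c])
      fix d assume d: "d \<in> factorizations G r" "d \<noteq> ?c"
      obtain p q where pq: "d = (p, q)"
        by (cases d)
      have "q \<notin> vertex_path ` verts G"
      proof
        assume "q \<in> vertex_path ` verts G"
        then obtain v where "q = vertex_path v"
          by auto
        then show False
          using d pq qpath_append_vertex_path(2)[of p] by (auto simp: factorizations_def)
      qed
      then show "(case d of (p, q) \<Rightarrow> f p \<otimes> \<one>\<^bsub>KG\<^esub> q) = \<zero>"
        using f by (simp add: pq path_algebra_simps)
    qed (use f path_algebra_one_closed in auto)
    then show ?thesis
      using f True qpath_ends_in_verts by (simp add: path_algebra_simps)
  next
    case False
    then show ?thesis
      using f by (simp add: path_algebra_simps factorizations_outside coeff_outside)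
  qed
qed

lemma path_algebra_add_closed:
  assumes "f \<in> carrier KG" "g \<in> carrier KG"
  shows "f \<oplus>\<^bsub>KG\<^esub> g \<in> carrier KG"
proof (rule path_algebra_carrierI)
  let ?S = "{p. f p \<noteq> \<zero>} \<union> {p. g p \<noteq> \<zero>}"
  show "finite ?S" "?S \<subseteq> qpaths G"
    using assms[THEN finite_support] assms[THEN support_subset] by simp_all
  fix p
  show "(f \<oplus>\<^bsub>KG\<^esub> g) p \<in> carrier K"
    using assms by (simp add: path_algebra_simps)
  show "p \<in> ?S" if "(f \<oplus>\<^bsub>KG\<^esub> g) p \<noteq> \<zero>"
  proof (rule ccontr)
    assume "p \<notin> ?S"
    then have "f p = \<zero>" "g p = \<zero>"
      by simp_all
    with that show False
      by (simp add: path_algebra_simps)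
  qed
qed

lemma abelian_group_path_algebra: "abelian_group KG"
proof (rule abelian_groupI)
  fix f assume f: "f \<in> carrier KG"
  have "(\<lambda>p. \<ominus> f p) \<in> carrier KG"
    by (rule path_algebra_carrierI[of _ "{p. f p \<noteq> \<zero>}"])
      (use f in \<open>auto simp: finite_support dest: support_subset\<close>)
  moreover have "(\<lambda>p. \<ominus> f p) \<oplus>\<^bsub>KG\<^esub> f = \<zero>\<^bsub>KG\<^esub>"
    using f by (simp add: path_algebra_simps l_neg)
  ultimately show "\<exists>g \<in> carrier KG. g \<oplus>\<^bsub>KG\<^esub> f = \<zero>\<^bsub>KG\<^esub>"
    by blast
next
  show "\<zero>\<^bsub>KG\<^esub> \<in> carrier KG"
    by (rule path_algebra_carrierI[of _ "{}"]) (simp_all add: path_algebra_simps)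
next
  fix f g h assume "f \<in> carrier KG" "g \<in> carrier KG" "h \<in> carrier KG"
  then show "(f \<oplus>\<^bsub>KG\<^esub> g) \<oplus>\<^bsub>KG\<^esub> h = f \<oplus>\<^bsub>KG\<^esub> (g \<oplus>\<^bsub>KG\<^esub> h)"
    by (simp add: path_algebra_simps a_assoc)
next
  fix f g assume "f \<in> carrier KG" "g \<in> carrier KG"
  then show "f \<oplus>\<^bsub>KG\<^esub> g = g \<oplus>\<^bsub>KG\<^esub> f"
    by (simp add: path_algebra_simps a_comm)
qed (simp_all add: path_algebra_add_closed, simp_all add: path_algebra_simps)

lemma ring_path_algebra: "ring KG"
proof (rule ringI[OF abelian_group_path_algebra])
  show "monoid KG"
    by (rule monoidI) (simp_all add: path_algebra_mult_closed path_algebra_one_closed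
        path_algebra_assoc path_algebra_l_one path_algebra_r_one)
next
  fix f g h assume "f \<in> carrier KG" "g \<in> carrier KG" "h \<in> carrier KG"
  note fgh = this
  show "(f \<oplus>\<^bsub>KG\<^esub> g) \<otimes>\<^bsub>KG\<^esub> h = f \<otimes>\<^bsub>KG\<^esub> h \<oplus>\<^bsub>KG\<^esub> g \<otimes>\<^bsub>KG\<^esub> h"
    using fgh by (simp add: path_algebra_simps l_distr case_prod_unfold Pi_iff)
  show "h \<otimes>\<^bsub>KG\<^esub> (f \<oplus>\<^bsub>KG\<^esub> g) = h \<otimes>\<^bsub>KG\<^esub> f \<oplus>\<^bsub>KG\<^esub> h \<otimes>\<^bsub>KG\<^esub> g"
    using fgh by (simp add: path_algebra_simps r_distr case_prod_unfold Pi_iff)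
qed

section \<open>The commuting ideal contains no path\<close>

text \<open>
  The entry at \<open>(u, v)\<close> of the matrix of \<open>f\<close>. Summing over the support keeps the index set finite:
  there may be infinitely many paths from \<open>u\<close> to \<open>v\<close>.
\<close>

definition path_sum :: "(('v, 'e) qpath \<Rightarrow> 'k) \<Rightarrow> 'v \<Rightarrow> 'v \<Rightarrow> 'k" where
  "path_sum f u v = (\<Oplus>p\<in>{p. f p \<noteq> \<zero> \<and> qpath_start p = u \<and> qpath_end p = v}. f p)"

lemma path_sum_eq:
  assumes f: "f \<in> carrier KG" and "finite S"
    and S: "\<And>p. p \<in> S \<Longrightarrow> qpath_start p = u \<and> qpath_end p = v"
    and supp: "\<And>p. f p \<noteq> \<zero> \<Longrightarrow> qpath_start p = u \<Longrightarrow> qpath_end p = v \<Longrightarrow> p \<in> S"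
  shows "path_sum f u v = (\<Oplus>p\<in>S. f p)"
  unfolding path_sum_def
proof (rule add.finprod_mono_neutral_cong_left)
  show "{p. f p \<noteq> \<zero> \<and> qpath_start p = u \<and> qpath_end p = v} \<subseteq> S"
    using supp by blast
  show "f p = \<zero>" if "p \<in> S - {p. f p \<noteq> \<zero> \<and> qpath_start p = u \<and> qpath_end p = v}" for p
    using that S by blast
qed (use f \<open>finite S\<close> in auto)

lemma path_sum_closed [simp]: "f \<in> carrier KG \<Longrightarrow> path_sum f u v \<in> carrier K"
  unfolding path_sum_def by (intro finsum_closed) auto

lemma path_sum_zero: "path_sum \<zero>\<^bsub>KG\<^esub> u v = \<zero>"
  by (simp add: path_sum_def path_algebra_simps)

lemma path_sum_add:
  assumes "f \<in> carrier KG" "g \<in> carrier KG"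
  shows "path_sum (f \<oplus>\<^bsub>KG\<^esub> g) u v = path_sum f u v \<oplus> path_sum g u v"
proof -
  define S where "S = ({p. f p \<noteq> \<zero>} \<union> {p. g p \<noteq> \<zero>}) \<inter> {p. qpath_start p = u \<and> qpath_end p = v}"
  have "finite S"
    unfolding S_def using assms[THEN finite_support] by (intro finite_Int disjI1 finite_UnI)
  have add_supp: "f p \<noteq> \<zero> \<or> g p \<noteq> \<zero>" if "(f \<oplus>\<^bsub>KG\<^esub> g) p \<noteq> \<zero>" for p
    using that unfolding path_algebra_simps by force
  have "path_sum (f \<oplus>\<^bsub>KG\<^esub> g) u v = (\<Oplus>p\<in>S. (f \<oplus>\<^bsub>KG\<^esub> g) p)"
    using assms \<open>finite S\<close> add_supp
    by (intro path_sum_eq path_algebra_add_closed) (auto simp: S_def)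
  moreover have "path_sum f u v = (\<Oplus>p\<in>S. f p)" "path_sum g u v = (\<Oplus>p\<in>S. g p)"
    using assms \<open>finite S\<close> by (intro path_sum_eq; auto simp: S_def)+
  ultimately show ?thesis
    using assms by (simp add: path_algebra_simps)
qed

lemma path_sum_minus:
  assumes f: "f \<in> carrier KG"
  shows "path_sum (\<ominus>\<^bsub>KG\<^esub> f) u v = \<ominus> path_sum f u v"
proof -
  interpret KG: abelian_group KG
    by (rule abelian_group_path_algebra)
  have "path_sum (\<ominus>\<^bsub>KG\<^esub> f) u v \<oplus> path_sum f u v = path_sum (\<ominus>\<^bsub>KG\<^esub> f \<oplus>\<^bsub>KG\<^esub> f) u v"
    using f by (simp add: path_sum_add)
  also have "\<dots> = \<zero>"
    using f by (simp only: KG.l_neg path_sum_zero)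
  finally show ?thesis
    using f by (intro minus_equality[symmetric]) auto
qed

text \<open>
  A path pair \<open>(p, q)\<close> contributes to the entry at \<open>(u, v)\<close> if \<open>p\<close> starts at \<open>u\<close>,
  \<open>q\<close> ends at \<open>v\<close>, and \<open>p\<close> ends where \<open>q\<close> starts. Let \<open>C\<close> be the finite set of these pairs with
  nonzero coefficients. Grouping \<open>C\<close> by the concatenation \<open>p q\<close> gives the entry of the product, and
  grouping it by the vertex where \<open>p\<close> and \<open>q\<close> meet gives the matrix product.
\<close>

lemma path_sum_mult:
  assumes f: "f \<in> carrier KG" and g: "g \<in> carrier KG"
  shows "path_sum (f \<otimes>\<^bsub>KG\<^esub> g) u v = (\<Oplus>x\<in>verts G. path_sum f u x \<otimes> path_sum g x v)"
proof -
  define A where "A x = {p. f p \<noteq> \<zero> \<and> qpath_start p = u \<and> qpath_end p = x}" for x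
  define B where "B x = {q. g q \<noteq> \<zero> \<and> qpath_start q = x \<and> qpath_end q = v}" for x
  define C where "C = (\<Union>x\<in>verts G. A x \<times> B x)"
  define app where "app = (\<lambda>c :: ('v, 'e) qpath \<times> ('v, 'e) qpath. qpath_append (fst c) (snd c))"
  have A: "finite (A x)" and B: "finite (B x)" for x
    using finite_subset[OF _ finite_support[OF f], of "A x"]
      finite_subset[OF _ finite_support[OF g], of "B x"]
    unfolding A_def B_def by blast+
  have C: "finite C"
    unfolding C_def using A B by (intro finite_UN_I finite_cartesian_product) simp_all
  have fg: "(\<lambda>c. f (fst c) \<otimes> g (snd c)) \<in> S \<rightarrow> carrier K" for S
    using f g by simp
  have C_iff: "(p, q) \<in> C \<longleftrightarrow> f p \<noteq> \<zero> \<and> g q \<noteq> \<zero> \<and> qpath_start p = u \<and> qpath_end q = v \<and>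
      qpath_end p = qpath_start q" for p q
    using support_subset[OF f] qpath_ends_in_verts(2)[of p] unfolding C_def A_def B_def by auto
  have C_factor: "c \<in> factorizations G (app c) \<and> qpath_start (app c) = u \<and> qpath_end (app c) = v"
    if "c \<in> C" for c
  proof -
    obtain p q where c: "c = (p, q)"
      by (rule prod.exhaust)
    show ?thesis
      using that support_subset[OF f] support_subset[OF g]
      unfolding c C_iff app_def factorizations_def by auto
  qed
  have "path_sum (f \<otimes>\<^bsub>KG\<^esub> g) u v = (\<Oplus>r\<in>app ` C. (f \<otimes>\<^bsub>KG\<^esub> g) r)"
  proof (rule path_sum_eq)
    fix r assume r: "(f \<otimes>\<^bsub>KG\<^esub> g) r \<noteq> \<zero>" "qpath_start r = u" "qpath_end r = v"
    obtain p q where pq: "(p, q) \<in> factorizations G r" "f p \<noteq> \<zero>" "g q \<noteq> \<zero>"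
      using f g r(1) by (rule convolution_nonzeroE)
    then have "app (p, q) = r" "qpath_end p = qpath_start q"
      unfolding factorizations_def app_def by simp_all
    with pq r have "(p, q) \<in> C"
      unfolding C_iff app_def by auto
    with \<open>app (p, q) = r\<close> show "r \<in> app ` C"
      by blast
  next
    fix r assume "r \<in> app ` C"
    then show "qpath_start r = u \<and> qpath_end r = v"
      using C_factor by auto
  qed (simp_all add: f g C path_algebra_mult_closed)
  also have "\<dots> = (\<Oplus>r\<in>app ` C. \<Oplus>c\<in>{c \<in> C. app c = r}. f (fst c) \<otimes> g (snd c))"
  proof (rule finsum_cong')
    fix r assume "r \<in> app ` C"
    then have r: "qpath_start r = u" "qpath_end r = v"
      using C_factor by auto
    have "(\<Oplus>c\<in>{c \<in> C. app c = r}. f (fst c) \<otimes> g (snd c)) =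
          (\<Oplus>c\<in>factorizations G r. f (fst c) \<otimes> g (snd c))"
    proof (rule add.finprod_mono_neutral_cong_left[OF finite_factorizations])
      show "{c \<in> C. app c = r} \<subseteq> factorizations G r"
        using C_factor by auto
      fix c assume c: "c \<in> factorizations G r - {c \<in> C. app c = r}"
      obtain p q where pq: "c = (p, q)"
        by (rule prod.exhaust)
      have "app c = r" "qpath_end p = qpath_start q"
        using c unfolding pq app_def factorizations_def by simp_all
      with c r have "f p = \<zero> \<or> g q = \<zero>"
        using C_iff[of p q] unfolding pq by (auto simp: app_def)
      then show "f (fst c) \<otimes> g (snd c) = \<zero>"
        using f g by (auto simp: pq)
    qed (use fg in auto)
    then show "(f \<otimes>\<^bsub>KG\<^esub> g) r = (\<Oplus>c\<in>{c \<in> C. app c = r}. f (fst c) \<otimes> g (snd c))"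
      by (simp add: path_algebra_simps case_prod_unfold)
  qed (use f g in \<open>auto intro!: finsum_closed\<close>)
  also have "\<dots> = (\<Oplus>c\<in>C. f (fst c) \<otimes> g (snd c))"
    by (rule finsum_fibres[OF C _ _ fg]) (use C in auto)
  also have "\<dots> = (\<Oplus>x\<in>verts G. \<Oplus>c\<in>{c \<in> C. qpath_end (fst c) = x}. f (fst c) \<otimes> g (snd c))"
    by (rule finsum_fibres[OF C finite_verts _ fg, symmetric]) (auto simp: C_def A_def)
  also have "\<dots> = (\<Oplus>x\<in>verts G. path_sum f u x \<otimes> path_sum g x v)"
  proof (rule finsum_cong')
    fix x assume "x \<in> verts G"
    then have "{c \<in> C. qpath_end (fst c) = x} = A x \<times> B x"
      by (auto simp: C_def A_def B_def)
    moreover have "path_sum f u x = (\<Oplus>p\<in>A x. f p)" "path_sum g x v = (\<Oplus>q\<in>B x. g q)"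
      by (simp_all add: path_sum_def A_def B_def)
    ultimately show "(\<Oplus>c\<in>{c \<in> C. qpath_end (fst c) = x}. f (fst c) \<otimes> g (snd c)) =
        path_sum f u x \<otimes> path_sum g x v"
      using f g A B by (simp add: finsum_product case_prod_unfold)
  qed (use f g in auto)
  finally show ?thesis .
qed

lemma ideal_path_sum_kernel: "ideal {f \<in> carrier KG. \<forall>u v. path_sum f u v = \<zero>} KG" (is "ideal ?N KG")
proof (rule idealI[OF ring_path_algebra])
  interpret KG: ring KG
    by (rule ring_path_algebra)
  show "subgroup ?N (add_monoid KG)"
  proof (rule KG.add.subgroupI)
    show "?N \<noteq> {}"
      using path_sum_zero KG.zero_closed by blast
  qed (auto simp: path_sum_add path_sum_minus simp flip: a_inv_def)
  fix f g assume "f \<in> ?N" "g \<in> carrier KG"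
  then show "g \<otimes>\<^bsub>KG\<^esub> f \<in> ?N" "f \<otimes>\<^bsub>KG\<^esub> g \<in> ?N"
    by (simp_all add: path_sum_mult)
qed

lemma path_elem_closed:
  assumes "p \<in> qpaths G"
  shows "path_elem K p \<in> carrier KG"
  by (rule path_algebra_carrierI[of _ "{p}"])
    (use assms in \<open>auto simp: path_elem_def split: if_splits\<close>)

lemma path_sum_path_elem:
  assumes "p \<in> qpaths G"
  shows "path_sum (path_elem K p) u v = (if qpath_start p = u \<and> qpath_end p = v then \<one> else \<zero>)"
proof (cases "qpath_start p = u \<and> qpath_end p = v")
  case True
  have "path_sum (path_elem K p) u v = (\<Oplus>q\<in>{p}. path_elem K p q)"
    by (rule path_sum_eq[OF path_elem_closed[OF assms]])
      (use True in \<open>auto simp: path_elem_def split: if_splits\<close>)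
  also have "\<dots> = \<one>"
    by (simp add: path_elem_def)
  finally show ?thesis
    using True by simp
next
  case False
  have "path_sum (path_elem K p) u v = (\<Oplus>q\<in>{}. path_elem K p q)"
    by (rule path_sum_eq[OF path_elem_closed[OF assms]])
      (use False in \<open>auto simp: path_elem_def split: if_splits\<close>)
  then show ?thesis
    using False by auto
qed

abbreviation commuting_generators :: "(('v, 'e) qpath \<Rightarrow> 'k) set" where
  "commuting_generators \<equiv> {path_elem K p \<ominus>\<^bsub>KG\<^esub> path_elem K q | p q.
     p \<in> qpaths G \<and> q \<in> qpaths G \<and> parallel_paths p q}"

lemma ideal_commuting_ideal: "ideal (commuting_ideal K G) KG"
proof -
  interpret KG: ring KG
    by (rule ring_path_algebra)
  show ?thesis
    unfolding commuting_ideal_def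
    by (rule KG.genideal_ideal) (use path_elem_closed in blast)
qed

text \<open>
  Parallel paths have the same matrix, so the kernel contains the generators of the commuting ideal.
\<close>

lemma path_sum_commuting_ideal:
  assumes "f \<in> commuting_ideal K G"
  shows "path_sum f u v = \<zero>"
proof -
  interpret KG: ring KG
    by (rule ring_path_algebra)
  have "commuting_generators \<subseteq> {f \<in> carrier KG. \<forall>u v. path_sum f u v = \<zero>}"
    by (auto simp: a_minus_def path_elem_closed path_sum_add path_sum_minus path_sum_path_elem
        parallel_paths_def r_neg)
  then show ?thesis
    using KG.genideal_minimal[OF ideal_path_sum_kernel] assms
    unfolding commuting_ideal_def by blast
qed

text \<open>
  The matrix of a path \<open>p\<close> has the entry \<open>\<one>\<close> at the position given by the ends of \<open>p\<close>.
\<close>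

lemma path_elem_not_in_commuting_ideal:
  assumes "\<one> \<noteq> \<zero>" "p \<in> qpaths G"
  shows "path_elem K p \<notin> commuting_ideal K G"
  using path_sum_commuting_ideal[of "path_elem K p" "qpath_start p" "qpath_end p"] assms
  by (auto simp: path_sum_path_elem)

lemma ring_commuting_algebra: "ring (commuting_algebra K G)"
  unfolding commuting_algebra_def
  by (rule ring_extend[OF ideal.quotient_is_ring[OF ideal_commuting_ideal]])

lemma commuting_algebra_zero: "\<zero>\<^bsub>commuting_algebra K G\<^esub> = commuting_ideal K G"
  by (simp add: commuting_algebra_def ring.extend_def FactRing_def)

lemma commuting_proj_closed:
  assumes "f \<in> carrier KG"
  shows "commuting_proj K G f \<in> carrier (commuting_algebra K G)"
proof -
  have "carrier (commuting_algebra K G) = a_rcosets\<^bsub>KG\<^esub> commuting_ideal K G"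
    by (simp add: commuting_algebra_def ring.extend_def FactRing_def)
  then show ?thesis
    using assms unfolding commuting_proj_def A_RCOSETS_def' by blast
qed

lemma commuting_proj_path_elem_nonzero:
  assumes "\<one> \<noteq> \<zero>" "p \<in> qpaths G"
  shows "commuting_proj K G (path_elem K p) \<noteq> \<zero>\<^bsub>commuting_algebra K G\<^esub>"
proof
  interpret C: ideal "commuting_ideal K G" KG
    by (rule ideal_commuting_ideal)
  assume "commuting_proj K G (path_elem K p) = \<zero>\<^bsub>commuting_algebra K G\<^esub>"
  then have "path_elem K p \<in> commuting_ideal K G"
    using C.a_rcos_self[OF path_elem_closed[OF assms(2)]]
    by (simp add: commuting_proj_def commuting_algebra_zero)
  then show False
    using path_elem_not_in_commuting_ideal assms by blast
qed

end

section \<open>Coordinate projections of a direct sum of principal modules\<close>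

lemma finite_direct_sum_principal_simps:
  "carrier (finite_direct_sum I (\<lambda>i. principal_right_module A (e i))) =
     (\<Pi>\<^sub>E i\<in>I. e i <#\<^bsub>A\<^esub> carrier A)"
  "x \<otimes>\<^bsub>finite_direct_sum I (\<lambda>i. principal_right_module A (e i))\<^esub> y = (\<lambda>i\<in>I. x i \<oplus>\<^bsub>A\<^esub> y i)"
  "ract (finite_direct_sum I (\<lambda>i. principal_right_module A (e i))) x a = (\<lambda>i\<in>I. x i \<otimes>\<^bsub>A\<^esub> a)"
  by (simp_all add: finite_direct_sum_def principal_right_module_def product_group_def
      monoid.extend_def right_module.fields_def)

lemma (in ring) principal_right_ideal_closed:
  assumes "e \<in> carrier R"
  shows "x \<in> e <# carrier R \<Longrightarrow> x \<in> carrier R"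
    and "\<zero> \<in> e <# carrier R"
    and "e \<in> e <# carrier R"
    and "x \<in> e <# carrier R \<Longrightarrow> y \<in> e <# carrier R \<Longrightarrow> x \<oplus> y \<in> e <# carrier R"
    and "x \<in> e <# carrier R \<Longrightarrow> a \<in> carrier R \<Longrightarrow> x \<otimes> a \<in> e <# carrier R"
proof -
  have iff: "x \<in> e <# carrier R \<longleftrightarrow> (\<exists>a \<in> carrier R. x = e \<otimes> a)" for x
    by (auto simp: l_coset_def)
  show "x \<in> e <# carrier R \<Longrightarrow> x \<in> carrier R"
    using assms by (auto simp: iff)
  show "\<zero> \<in> e <# carrier R" "e \<in> e <# carrier R"
    using assms r_null[of e] r_one[of e] unfolding iff by (metis zero_closed, metis one_closed)
  show "x \<oplus> y \<in> e <# carrier R" if "x \<in> e <# carrier R" "y \<in> e <# carrier R"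
    using that assms unfolding iff by (metis a_closed r_distr)
  show "x \<otimes> a \<in> e <# carrier R" if "x \<in> e <# carrier R" "a \<in> carrier R"
    using that assms unfolding iff by (metis m_assoc m_closed)
qed

text \<open>
  The coordinates that the projection erases cause no trouble, since \<open>\<zero> \<oplus> \<zero> = \<zero>\<close> and
  \<open>\<zero> \<otimes> a = \<zero>\<close>.
\<close>

lemma summand_projection_in_module_End:
  fixes A :: "('k, 'a) module" and e :: "'i \<Rightarrow> 'a" and I :: "'i set"
  assumes "ring A" and e: "\<And>i. i \<in> I \<Longrightarrow> e i \<in> carrier A"
  defines "M \<equiv> finite_direct_sum I (\<lambda>i. principal_right_module A (e i))"
  shows "(\<lambda>z\<in>carrier M. \<lambda>j\<in>I. if j = i then z j else \<zero>\<^bsub>A\<^esub>) \<in> carrier (module_End A M)"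
proof -
  interpret A: ring A
    by fact
  note M_simps = finite_direct_sum_principal_simps[where A = A and I = I and e = e, folded M_def]
  note closed = A.principal_right_ideal_closed[OF e]
  let ?pr = "\<lambda>z\<in>carrier M. \<lambda>j\<in>I. if j = i then z j else \<zero>\<^bsub>A\<^esub>"
  have coord: "z j \<in> e j <#\<^bsub>A\<^esub> carrier A" if "z \<in> carrier M" "j \<in> I" for z j
    using that by (auto simp: M_simps)
  have add: "x \<otimes>\<^bsub>M\<^esub> y \<in> carrier M" if "x \<in> carrier M" "y \<in> carrier M" for x y
    using that closed(4) coord by (auto simp: M_simps)
  have act: "ract M x a \<in> carrier M" if "x \<in> carrier M" "a \<in> carrier A" for x a
    using that closed(5) coord by (auto simp: M_simps)
  have "?pr \<in> hom M M"
  proof (rule homI)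
    fix x assume "x \<in> carrier M"
    then show "?pr x \<in> carrier M"
      using coord closed(2) by (auto simp: M_simps(1))
  next
    fix x y assume xy: "x \<in> carrier M" "y \<in> carrier M"
    then have "?pr (x \<otimes>\<^bsub>M\<^esub> y) = (\<lambda>j\<in>I. if j = i then x j \<oplus>\<^bsub>A\<^esub> y j else \<zero>\<^bsub>A\<^esub>)"
      using add[OF xy] by (auto simp: M_simps(2))
    also have "\<dots> = ?pr x \<otimes>\<^bsub>M\<^esub> ?pr y"
      using xy by (auto simp: M_simps(2))
    finally show "?pr (x \<otimes>\<^bsub>M\<^esub> y) = ?pr x \<otimes>\<^bsub>M\<^esub> ?pr y" .
  qed
  moreover have "?pr (ract M x a) = ract M (?pr x) a" if xa: "x \<in> carrier M" "a \<in> carrier A" for x a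
  proof -
    have "?pr (ract M x a) = (\<lambda>j\<in>I. if j = i then x j \<otimes>\<^bsub>A\<^esub> a else \<zero>\<^bsub>A\<^esub>)"
      using act[OF xa] by (auto simp: M_simps(3))
    also have "\<dots> = ract M (?pr x) a"
      using xa by (auto simp: M_simps(3))
    finally show ?thesis .
  qed
  ultimately show ?thesis
    by (simp add: module_End_def)
qed

text \<open>
  The family of all the \<open>e\<^sub>i\<close> is an element of the direct sum. Its image under the \<open>i\<close>-th projection
  has the nonzero \<open>i\<close>-th coordinate \<open>e\<^sub>i\<close>, whereas all other projections make this coordinate zero.
\<close>

lemma inj_on_summand_projection:
  fixes A :: "('k, 'a) module" and e :: "'i \<Rightarrow> 'a" and I :: "'i set"
  assumes "ring A" and e: "\<And>i. i \<in> I \<Longrightarrow> e i \<in> carrier A" and nz: "\<And>i. i \<in> I \<Longrightarrow> e i \<noteq> \<zero>\<^bsub>A\<^esub>"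
  defines "M \<equiv> finite_direct_sum I (\<lambda>i. principal_right_module A (e i))"
  shows "inj_on (\<lambda>i. \<lambda>z\<in>carrier M. \<lambda>j\<in>I. if j = i then z j else \<zero>\<^bsub>A\<^esub>) I"
proof (rule inj_onI, rule ccontr)
  interpret A: ring A
    by fact
  fix i k assume ik: "i \<in> I" "k \<in> I" "i \<noteq> k"
    and eq: "(\<lambda>z\<in>carrier M. \<lambda>j\<in>I. if j = i then z j else \<zero>\<^bsub>A\<^esub>) =
      (\<lambda>z\<in>carrier M. \<lambda>j\<in>I. if j = k then z j else \<zero>\<^bsub>A\<^esub>)"
  have "restrict e I \<in> carrier M"
    using A.principal_right_ideal_closed(3)[OF e]
    by (auto simp: M_def finite_direct_sum_principal_simps)
  then have "e i = \<zero>\<^bsub>A\<^esub>"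
    using fun_cong[OF fun_cong[OF eq, of "restrict e I"], of i] ik by simp
  with nz ik show False
    by blast
qed

section \<open>The order on the vertices of the skeleton\<close>

lemma (in wf_digraph) path_between_trans:
  assumes "path_between G u v" "path_between G v x"
  shows "path_between G u x"
proof -
  obtain p q where "p \<in> qpaths G" "qpath_start p = u" "qpath_end p = v"
    and "q \<in> qpaths G" "qpath_start q = v" "qpath_end q = x"
    using assms unfolding path_between_def by blast
  then have "qpath_append p q \<in> qpaths G" "qpath_start (qpath_append p q) = u"
    "qpath_end (qpath_append p q) = x"
    by (simp_all add: qpath_append_in_qpaths)
  then show ?thesis
    unfolding path_between_def by blast
qed

lemma (in wf_digraph) path_between_refl: "v \<in> verts G \<Longrightarrow> path_between G v v"
  unfolding path_between_def
  by (rule bexI[of _ "vertex_path v"]) (simp_all add: vertex_path_in_qpaths)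

lemma (in wf_digraph) equiv_path_equiv: "equiv (verts G) (path_equiv G)"
proof (rule equivI)
  show "refl_on (verts G) (path_equiv G)"
    by (auto simp: refl_on_def path_equiv_def path_between_refl)
  show "sym (path_equiv G)"
    by (auto simp: sym_def path_equiv_def)
  show "trans (path_equiv G)"
    by (auto simp: trans_def path_equiv_def intro: path_between_trans)
qed (auto simp: path_equiv_def)

theorem proposition6p2:
  fixes K :: "('k, 'm) ring_scheme"
    and Q :: "('v, 'e) pre_digraph"
    and m :: nat
    and D :: "nat \<Rightarrow> 'v set"
    and w :: "nat \<Rightarrow> 'v"
  assumes "field K"
    and "fin_digraph Q"
    and "bij_betw D {1..m} (path_connected_components Q)"
    and "\<And>i. i \<in> {1..m} \<Longrightarrow> w i \<in> D i"
  shows "(\<forall>i \<in> {1..m}. \<forall>j \<in> {1..m}.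
            (skeleton_vertex K Q {1..m} w i, skeleton_vertex K Q {1..m} w j)
                \<in> skeleton_le K Q {1..m} w
              \<longleftrightarrow> path_between Q (w i) (w j))
         \<and> partial_order_on (skeleton_vertices K Q {1..m} w) (skeleton_le K Q {1..m} w)"
proof -
  interpret K: field K
    by fact
  interpret Q: fin_digraph Q
    by fact
  interpret quiver_over_ring K Q
    by unfold_locales
  define I where "I = {1..m}"
  define x where "x = skeleton_vertex K Q I w"
  let ?A = "commuting_algebra K Q"
  let ?e = "\<lambda>i. commuting_proj K Q (path_elem K (vertex_path (w i)))"
  have component: "D i \<in> path_connected_components Q" "w i \<in> D i" if "i \<in> I" for i
    using that assms(3,4) by (auto simp: I_def bij_betw_def)
  then have w: "w i \<in> verts Q" if "i \<in> I" for i
    using that in_quotient_imp_subset[OF Q.equiv_path_equiv]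
    unfolding path_connected_components_def by blast
  have e: "?e i \<in> carrier ?A" "?e i \<noteq> \<zero>\<^bsub>?A\<^esub>" if "i \<in> I" for i
    using w[OF that] K.one_not_zero
    by (simp_all add: commuting_proj_closed path_elem_closed Q.vertex_path_in_qpaths
        commuting_proj_path_elem_nonzero)
  have x_in: "x i \<in> carrier (skeleton K Q I w)" for i
    unfolding x_def skeleton_vertex_def skeleton_def skeleton_module_def
    by (rule summand_projection_in_module_End[OF ring_commuting_algebra e(1)])
  have inj: "inj_on x I"
    unfolding x_def skeleton_vertex_def skeleton_module_def
    by (rule inj_on_summand_projection[OF ring_commuting_algebra e])
  have verts: "skeleton_vertices K Q I w = x ` I"
    using x_in by (auto simp: skeleton_vertices_def x_def)
  have le: "skeleton_le K Q I w = {(x i, x j) | i j. i \<in> I \<and> j \<in> I \<and> path_between Q (w i) (w j)}"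
    by (simp add: skeleton_le_def x_def)
  have le_iff: "(x i, x j) \<in> skeleton_le K Q I w \<longleftrightarrow> path_between Q (w i) (w j)"
    if "i \<in> I" "j \<in> I" for i j
    using that inj unfolding le by (auto dest: inj_onD)
  \<comment> \<open>Vertices that reach each other lie in one component, and each component has one index.\<close>
  have anti: "i = j" if ij: "i \<in> I" "j \<in> I" and "path_between Q (w i) (w j)" "path_between Q (w j) (w i)" for i j
  proof -
    have "(w i, w j) \<in> path_equiv Q"
      using that w by (simp add: path_equiv_def)
    then have "D i = D j"
      using quotient_eq_iff[OF Q.equiv_path_equiv] component[OF ij(1)] component[OF ij(2)]
      unfolding path_connected_components_def by blast
    then show ?thesis
      using ij assms(3) by (auto simp: I_def bij_betw_def dest: inj_onD)
  qed
  have "skeleton_le K Q I w \<subseteq> x ` I \<times> x ` I"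
    by (auto simp: le)
  moreover have "refl_on (x ` I) (skeleton_le K Q I w)"
    using w by (auto simp: refl_on_def le_iff Q.path_between_refl)
  moreover have "trans (skeleton_le K Q I w)"
  proof (rule transI)
    fix a b c assume ab: "(a, b) \<in> skeleton_le K Q I w" and bc: "(b, c) \<in> skeleton_le K Q I w"
    obtain i j where ij: "a = x i" "b = x j" "i \<in> I" "j \<in> I"
      using ab unfolding le by blast
    obtain k where k: "c = x k" "k \<in> I"
      using bc unfolding le by blast
    have "path_between Q (w i) (w j)" "path_between Q (w j) (w k)"
      using ab bc le_iff[OF ij(3,4)] le_iff[OF ij(4) k(2)] by (simp_all add: ij k)
    then have "path_between Q (w i) (w k)"
      by (rule Q.path_between_trans)
    then show "(a, c) \<in> skeleton_le K Q I w"
      using le_iff[OF ij(3) k(2)] by (simp add: ij k)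
  qed
  moreover have "antisym (skeleton_le K Q I w)"
  proof (rule antisymI)
    fix a b assume ab: "(a, b) \<in> skeleton_le K Q I w" "(b, a) \<in> skeleton_le K Q I w"
    obtain i j where ij: "a = x i" "b = x j" "i \<in> I" "j \<in> I"
      using ab(1) unfolding le by blast
    have "path_between Q (w i) (w j)" "path_between Q (w j) (w i)"
      using ab le_iff[OF ij(3,4)] le_iff[OF ij(4,3)] by (simp_all add: ij)
    with ij show "a = b"
      using anti by blast
  qed
  ultimately have "partial_order_on (skeleton_vertices K Q I w) (skeleton_le K Q I w)"
    by (simp add: verts partial_order_on_def preorder_on_def)
  with le_iff[unfolded x_def] show ?thesis
    unfolding I_def by blast
qed

end
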